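(* Let $(Q_n)_{n\in\mathbb{Z}}$ be the Pell-Lucas numbers, i.e. the integer sequence determined by $Q_0=2$, $Q_1=2$ and $Q_n=2Q_{n-1}+Q_{n-2}$ for all $n\in\mathbb{Z}$ (so that the recurrence also defines $Q_n$ for negative $n$, e.g. $Q_{-1}=-2$). For an integer $m>1$ and $z\in\mathbb{C}\setminus\mathbb{R}$ define the Pell-Lucas-Eisenstein series $$Q_m(z):=\sum_{j=-\infty}^{\infty}\left(Q_j z+Q_{j-1}\right)^{-m}.$$ Then for every integer $m>1$ this series converges for every $z\in\mathbb{C}\setminus\mathbb{R}$.
   Context: The Pell-Lucas numbers: $Q_0=Q_1=2$, $Q_n=2Q_{n-1}+Q_{n-2}$, extended to all integer indices via the same recurrence; thus $Q_2=6$, $Q_3=14$, $Q_4=34,\dots$ and $Q_{-1}=-2$, $Q_{-2}=6,\dots$. The Pell-Lucas-Eisenstein series of weight $m$ is $Q_m(z)=\sum_{j\in\mathbb{Z}}(Q_jz+Q_{j-1})^{-m}$ (a two-sided series over all integers $j$). *)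

theory Defs
  imports Complex_Main
begin

text \<open>For negative indices the recurrence is read backwards:
  \<open>Q\<^sub>n = Q\<^sub>n\<^sub>+\<^sub>2 - 2 Q\<^sub>n\<^sub>+\<^sub>1\<close>. Lemma \<open>pell_lucas_rec\<close> gives the recurrence in its usual form for
  all integer indices.\<close>

function pell_lucas :: "int \<Rightarrow> int" where
  "pell_lucas n =
     (if n < 0 then pell_lucas (n + 2) - 2 * pell_lucas (n + 1)
      else if n < 2 then 2
      else 2 * pell_lucas (n - 1) + pell_lucas (n - 2))"
  by auto
termination
  by (relation "measure (\<lambda>n. if n < 0 then nat (2 - n) else nat n)") auto

declare pell_lucas.simps [simp del]

lemma pell_lucas_0: "pell_lucas 0 = 2"
  by (simp add: pell_lucas.simps[of 0])

lemma pell_lucas_1: "pell_lucas 1 = 2"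
  by (simp add: pell_lucas.simps[of 1])

lemma pell_lucas_rec: "pell_lucas n = 2 * pell_lucas (n - 1) + pell_lucas (n - 2)"
  using pell_lucas.simps[of n] pell_lucas.simps[of "n - 2"]
  by (cases "n < 2") (simp_all add: algebra_simps)

text \<open>Convergence of a two-sided series: the two bounds of the partial sums tend to infinity
  independently, so this is stronger than convergence of the symmetric partial sums.\<close>

definition bilateral_sums :: "(int \<Rightarrow> 'a::real_normed_vector) \<Rightarrow> 'a \<Rightarrow> bool" where
  "bilateral_sums f s \<longleftrightarrow>
     ((\<lambda>(M, N). \<Sum>j = - int M..int N. f j) \<longlongrightarrow> s) (sequentially \<times>\<^sub>F sequentially)"

definition bilateral_suminf :: "(int \<Rightarrow> 'a::real_normed_vector) \<Rightarrow> 'a" where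
  "bilateral_suminf f = (THE s. bilateral_sums f s)"

lemma bilateral_sums_unique:
  assumes "bilateral_sums f s" and "bilateral_sums f t"
  shows "s = t"
  using assms unfolding bilateral_sums_def
  by (rule tendsto_unique[rotated]) (simp add: prod_filter_eq_bot)

text \<open>Since \<open>bilateral_suminf\<close> is arbitrary for a divergent series, convergence has to be expressed by
  \<open>bilateral_sums\<close>.\<close>

definition pell_lucas_eisenstein_term :: "int \<Rightarrow> complex \<Rightarrow> int \<Rightarrow> complex" where
  "pell_lucas_eisenstein_term m z j =
     (of_int (pell_lucas j) * z + of_int (pell_lucas (j - 1))) powi (- m)"

definition pell_lucas_eisenstein :: "int \<Rightarrow> complex \<Rightarrow> complex" where
  "pell_lucas_eisenstein m z = bilateral_suminf (pell_lucas_eisenstein_term m z)"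

end

theory Submission
  imports Defs
begin

text \<open>Since the Pell-Lucas numbers are real, the norm of \<open>Q\<^sub>j z + Q\<^sub>j\<^sub>-\<^sub>1\<close> is at least \<open>\<bar>Q\<^sub>j\<bar> \<bar>Im z\<bar>\<close>, and
  \<open>\<bar>Q\<^sub>j\<bar> \<ge> 2\<^bsup>\<bar>j\<bar>\<^esup>\<close>. Hence both halves of the series are dominated by geometric series.\<close>

text \<open>Earlier terms being nonnegative, each use of the recurrence at least doubles the last
  term.\<close>

lemma pell_lucas_ge_power: "pell_lucas (int n) \<ge> 2 ^ n"
proof (induction n rule: induct_nat_012)
  case (ge2 n)
  have "pell_lucas (int (Suc (Suc n))) = 2 * pell_lucas (int (Suc n)) + pell_lucas (int n)"
    using pell_lucas_rec[of "int (Suc (Suc n))"] by simp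
  moreover have "2 ^ Suc (Suc n) = 2 * (2 ^ Suc n :: int)" "(0::int) \<le> 2 ^ n"
    by simp_all
  ultimately show ?case
    using ge2 by linarith
qed (simp_all add: pell_lucas_0 pell_lucas_1)

text \<open>Running the recurrence backwards only flips the sign of the middle term, which the
  factor \<open>(- 1) ^ n\<close> absorbs. This carries the growth bound over to negative
  indices.\<close>

lemma pell_lucas_minus: "pell_lucas (- int n) = (- 1) ^ n * pell_lucas (int n)"
proof (induction n rule: induct_nat_012)
  case 1
  show ?case
    using pell_lucas_rec[of 1] by (simp add: pell_lucas_0 pell_lucas_1)
next
  case (ge2 n)
  have "pell_lucas (int (Suc (Suc n))) = 2 * pell_lucas (int (Suc n)) + pell_lucas (int n)"
    using pell_lucas_rec[of "int (Suc (Suc n))"] by simp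
  moreover have "pell_lucas (- int n) =
      2 * pell_lucas (- int (Suc n)) + pell_lucas (- int (Suc (Suc n)))"
  proof -
    have "- int (Suc n) = - int n - 1" "- int (Suc (Suc n)) = - int n - 2"
      by simp_all
    then show ?thesis
      using pell_lucas_rec[of "- int n"] by (simp only:)
  qed
  ultimately show ?case
    using ge2 by (simp add: algebra_simps)
qed simp

lemma abs_pell_lucas_ge_power: "\<bar>pell_lucas j\<bar> \<ge> 2 ^ nat \<bar>j\<bar>"
proof (cases j rule: int_cases2)
  case (nonneg n)
  then show ?thesis
    using pell_lucas_ge_power[of n] by simp
next
  case (nonpos n)
  then show ?thesis
    using pell_lucas_ge_power[of n] by (simp add: pell_lucas_minus abs_mult)
qed

lemma norm_pell_lucas_eisenstein_term_le:
  assumes "m > 1" and "z \<notin> \<real>"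
  shows "norm (pell_lucas_eisenstein_term m z j)
    \<le> inverse (\<bar>Im z\<bar> ^ nat m) * (1 / 2) ^ nat \<bar>j\<bar>"
proof -
  define w where "w = of_int (pell_lucas j) * z + of_int (pell_lucas (j - 1))"
  define n where "n = nat m"
  have n: "n \<ge> 1" "m = int n"
    using assms by (auto simp: n_def)
  have Im: "\<bar>Im z\<bar> > 0"
    using assms by (simp add: complex_is_Real_iff)
  have "(2::real) ^ nat \<bar>j\<bar> = of_int (2 ^ nat \<bar>j\<bar>)"
    by simp
  also have "\<dots> \<le> of_int \<bar>pell_lucas j\<bar>"
    using abs_pell_lucas_ge_power by (simp only: of_int_le_iff)
  finally have "2 ^ nat \<bar>j\<bar> * \<bar>Im z\<bar> \<le> \<bar>of_int (pell_lucas j)\<bar> * \<bar>Im z\<bar>"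
    by (intro mult_right_mono) auto
  also have "\<dots> = \<bar>Im w\<bar>"
    by (simp add: w_def abs_mult)
  also have "\<dots> \<le> norm w"
    by (rule abs_Im_le_cmod)
  finally have "(2 ^ nat \<bar>j\<bar> * \<bar>Im z\<bar>) ^ n \<le> norm w ^ n"
    by (intro power_mono) auto
  \<comment> \<open>Weakening the power of 2 here lets the single ratio 1/2 serve every
    \<open>m\<close>.\<close>
  moreover have "(2::real) ^ nat \<bar>j\<bar> \<le> (2 ^ nat \<bar>j\<bar>) ^ n"
    using n by (intro self_le_power) auto
  then have "2 ^ nat \<bar>j\<bar> * \<bar>Im z\<bar> ^ n \<le> (2 ^ nat \<bar>j\<bar> * \<bar>Im z\<bar>) ^ n"
    unfolding power_mult_distrib by (intro mult_right_mono) auto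
  ultimately have "2 ^ nat \<bar>j\<bar> * \<bar>Im z\<bar> ^ n \<le> norm w ^ n"
    by linarith
  \<comment> \<open>Since \<open>z\<close> is not real, the lower bound is positive. Thus
    \<open>w\<close> is nonzero, and no term takes the default value of
    \<open>0 powi (- m)\<close>.\<close>
  then have "inverse (norm w ^ n) \<le> inverse (2 ^ nat \<bar>j\<bar> * \<bar>Im z\<bar> ^ n)"
    using Im by (intro le_imp_inverse_le) auto
  then show ?thesis
    unfolding pell_lucas_eisenstein_term_def w_def[symmetric] n_def[symmetric]
    by (simp add: n(2) power_int_minus norm_divide norm_power power_one_over inverse_eq_divide mult.commute)
qed

lemma bilateral_sums_suminf:
  assumes "\<exists>s. bilateral_sums f s"
  shows "bilateral_sums f (bilateral_suminf f)"
  using assms bilateral_sums_unique unfolding bilateral_suminf_def by (metis theI)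

text \<open>Cutting at 0 writes the partial sum as a function of \<open>N\<close> alone plus a
  function of \<open>M\<close> alone, so the two bounds may tend to infinity independently.\<close>

lemma bilateral_sumsI:
  assumes "(\<lambda>n. f (int n)) sums s" and "(\<lambda>n. f (- int (Suc n))) sums t"
  shows "bilateral_sums f (s + t)"
proof -
  \<comment> \<open>The index 0 belongs to the first sum; the second runs over -1, ...,
    -\<open>M\<close>. Induction on \<open>M\<close> adds one term at the left end.\<close>
  have split: "(\<Sum>j = - int M..int N. f j) =
      (\<Sum>n\<le>N. f (int n)) + (\<Sum>n<M. f (- int (Suc n)))" for M N
  proof (induction M)
    case 0
    have "(\<Sum>j = 0..int N. f j) = (\<Sum>n\<le>N. f (int n))"
      by (rule sum.reindex_bij_witness[of _ int nat]) auto
    then show ?case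
      by simp
  next
    case (Suc M)
    have "{- int (Suc M)..int N} = insert (- int (Suc M)) {- int M..int N}"
      by auto
    with Suc show ?case
      by (simp add: algebra_simps)
  qed
  have "(\<lambda>N. \<Sum>n\<le>N. f (int n)) \<longlonglongrightarrow> s"
    using assms(1) by (simp only: sums_def_le)
  moreover have "(\<lambda>M. \<Sum>n<M. f (- int (Suc n))) \<longlonglongrightarrow> t"
    using assms(2) by (simp only: sums_def)
  ultimately have "((\<lambda>p. (\<Sum>n\<le>snd p. f (int n)) + (\<Sum>n<fst p. f (- int (Suc n)))) \<longlongrightarrow> s + t)
      (sequentially \<times>\<^sub>F sequentially)"
    \<comment> \<open>Each one-sided limit is composed with a projection of the product filter,
      which tends to \<open>sequentially\<close>.\<close>
    by (intro tendsto_add) (rule filterlim_compose, assumption, simp add: filterlim_def filtermap_fst_prod_filter filtermap_snd_prod_filter)+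
  then show ?thesis
    by (simp add: bilateral_sums_def split case_prod_unfold)
qed

theorem theorem1:
  fixes m :: int and z :: complex
  assumes "m > 1" and "z \<notin> \<real>"
  shows "bilateral_sums (pell_lucas_eisenstein_term m z) (pell_lucas_eisenstein m z)"
proof -
  let ?f = "pell_lucas_eisenstein_term m z" and ?C = "inverse (\<bar>Im z\<bar> ^ nat m)"
  have geometric: "summable (\<lambda>n. ?C * (1 / 2) ^ n)"
    by (intro summable_mult summable_geometric) simp
  have "norm (?f (int n)) \<le> ?C * (1 / 2) ^ n" for n
    using norm_pell_lucas_eisenstein_term_le[OF assms, of "int n"] by simp
  then have pos: "summable (\<lambda>n. ?f (int n))"
    by (intro summable_comparison_test'[OF geometric])
  \<comment> \<open>The left half starts at -1, so its majorant is the geometric series without its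
    first term.\<close>
  have "norm (?f (- int (Suc n))) \<le> ?C * (1 / 2) ^ Suc n" for n
    using norm_pell_lucas_eisenstein_term_le[OF assms, of "- int (Suc n)"]
    by (simp only: abs_minus_cancel abs_of_nat nat_int)
  then have neg: "summable (\<lambda>n. ?f (- int (Suc n)))"
    by (intro summable_comparison_test'[OF summable_ignore_initial_segment[OF geometric, of 1]])
      (simp only: Suc_eq_plus1)
  show ?thesis
    unfolding pell_lucas_eisenstein_def
    \<comment> \<open>This gives some limit; uniqueness identifies it with
      \<open>bilateral_suminf\<close>.\<close>
    using bilateral_sumsI[OF summable_sums[OF pos] summable_sums[OF neg]]
    by (blast intro: bilateral_sums_suminf)
qed

end
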